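(* Let $L$ be a finite-dimensional Leibniz algebra over $\mathbb{C}$ and let $D$ be a derivation of $L$. Then there exist a unique diagonalizable derivation $D_0$ of $L$ and a unique nilpotent derivation $T$ of $L$ such that $D = D_0 + T$ and $D_0 T = T D_0$.
   Context: A (right) Leibniz algebra over a field $F$ is an $F$-vector space $L$ with a bilinear multiplication $[-,-]$ satisfying $[[x,y],z]=[[x,z],y]+[x,[y,z]]$ for all $x,y,z\in L$. A derivation of $L$ is a linear map $d\colon L\to L$ with $d([x,y])=[d(x),y]+[x,d(y)]$ for all $x,y\in L$. A derivation is called diagonalizable (resp. nilpotent) if it is so as a linear operator on $L$. Uniqueness refers to the pair $(D_0,T)$ with the stated properties. *)

theory Defs
  imports Complex_Main
begin

text \<open>The underlying vector space is an entire type. Both predicates below are meant for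
  linear operators; linearity is part of \<open>derivation\<close>.\<close>

context vector_space
begin

definition diagonalizable :: "('b \<Rightarrow> 'b) \<Rightarrow> bool" where
  "diagonalizable f \<longleftrightarrow>
     (\<exists>B. independent B \<and> span B = UNIV \<and> (\<forall>b\<in>B. \<exists>c. f b = scale c b))"

definition nilpotent :: "('b \<Rightarrow> 'b) \<Rightarrow> bool" where
  "nilpotent f \<longleftrightarrow> (\<exists>n. \<forall>x. (f ^^ n) x = 0)"

end

locale right_leibniz_algebra = vector_space scale
  for scale :: "'f::field \<Rightarrow> 'a::ab_group_add \<Rightarrow> 'a" +
  fixes bracket :: "'a \<Rightarrow> 'a \<Rightarrow> 'a"
  assumes linear_left: "Vector_Spaces.linear scale scale (\<lambda>x. bracket x y)"
    and linear_right: "Vector_Spaces.linear scale scale (\<lambda>y. bracket x y)"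
    and leibniz: "bracket (bracket x y) z = bracket (bracket x z) y + bracket x (bracket y z)"
begin

definition derivation :: "('a \<Rightarrow> 'a) \<Rightarrow> bool" where
  "derivation d \<longleftrightarrow> Vector_Spaces.linear scale scale d \<and>
     (\<forall>x y. d (bracket x y) = bracket (d x) y + bracket x (d y))"

end

locale finite_dimensional_right_leibniz_algebra =
  right_leibniz_algebra scale bracket
  for scale :: "'f::field \<Rightarrow> 'a::ab_group_add \<Rightarrow> 'a" and bracket +
  assumes finite_dimensional: "\<exists>B. finite B \<and> span B = UNIV"

end

theory Submission
  imports Defs "HOL-Computational_Algebra.Fundamental_Theorem_Algebra"
begin

text \<open>The space \<open>L\<close> is the direct sum of the generalized eigenspaces \<open>L\<^sub>a\<close> of \<open>D\<close>, and \<open>D\<^sub>0\<close> acts on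
  \<open>L\<^sub>a\<close> as multiplication by \<open>a\<close>. It is a derivation because the bracket maps \<open>L\<^sub>a \<times> L\<^sub>b\<close> into
  \<open>L\<^sub>a\<^sub>+\<^sub>b\<close>. It is unique because in any decomposition with the stated properties \<open>D - c\<close> agrees with the
  nilpotent part on the \<open>c\<close>-eigenspace of the diagonalizable part, which therefore lies in \<open>L\<^sub>c\<close>.\<close>

section \<open>Generalized eigenspaces of a linear operator over an arbitrary field\<close>

locale linear_operator = vector_space scale
  for scale :: "'f::field \<Rightarrow> 'a::ab_group_add \<Rightarrow> 'a" (infixr "*s" 75) +
  fixes D :: "'a \<Rightarrow> 'a"
  assumes linear_D: "Vector_Spaces.linear scale scale D"
begin

sublocale endo: vector_space_pair scale scale ..

lemma D_add: "D (x + y) = D x + D y"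
  and D_diff: "D (x - y) = D x - D y"
  and D_scale: "D (c *s x) = c *s D x"
  and D_zero: "D 0 = 0"
  using linear_D by (rule endo.linear_add endo.linear_diff endo.linear_scale endo.linear_0)+

definition shift :: "'f \<Rightarrow> 'a \<Rightarrow> 'a" where
  "shift a x = D x - a *s x"

definition gen_eigenspace :: "'f \<Rightarrow> 'a set" where
  "gen_eigenspace a = {x. \<exists>n. (shift a ^^ n) x = 0}"

lemma shift_add: "shift a (x + y) = shift a x + shift a y"
  by (simp add: shift_def D_add scale_right_distrib)

lemma shift_scale: "shift a (c *s x) = c *s shift a x"
  by (simp add: shift_def D_scale scale_right_diff_distrib mult.commute)

lemma shift_zero: "shift a 0 = 0"
  by (simp add: shift_def D_zero)

lemma shift_power_add: "(shift a ^^ n) (x + y) = (shift a ^^ n) x + (shift a ^^ n) y"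
  by (induction n) (simp_all add: shift_add)

lemma shift_power_scale: "(shift a ^^ n) (c *s x) = c *s (shift a ^^ n) x"
  by (induction n) (simp_all add: shift_scale)

lemma shift_power_zero: "(shift a ^^ n) 0 = 0"
  by (induction n) (simp_all add: shift_zero)

lemma shift_power_swap: "(shift a ^^ n) (shift a x) = shift a ((shift a ^^ n) x)"
  by (rule funpow_swap1[symmetric])

lemma shift_power_mono: "(shift a ^^ m) x = 0 \<Longrightarrow> m \<le> n \<Longrightarrow> (shift a ^^ n) x = 0"
  by (metis comp_apply funpow_add le_add_diff_inverse2 shift_power_zero)

lemma gen_eigenspaceI: "(shift a ^^ n) x = 0 \<Longrightarrow> x \<in> gen_eigenspace a"
  by (auto simp: gen_eigenspace_def)

lemma subspace_gen_eigenspace: "subspace (gen_eigenspace a)"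
proof (rule subspaceI)
  show "0 \<in> gen_eigenspace a"
    by (rule gen_eigenspaceI[where n = 0]) simp
next
  fix x y assume "x \<in> gen_eigenspace a" "y \<in> gen_eigenspace a"
  then obtain m n where "(shift a ^^ m) x = 0" "(shift a ^^ n) y = 0"
    by (auto simp: gen_eigenspace_def)
  then have "(shift a ^^ max m n) x = 0" "(shift a ^^ max m n) y = 0"
    by (meson shift_power_mono max.cobounded1 max.cobounded2)+
  then have "(shift a ^^ max m n) (x + y) = 0"
    by (simp add: shift_power_add)
  then show "x + y \<in> gen_eigenspace a"
    by (rule gen_eigenspaceI)
next
  fix c x assume "x \<in> gen_eigenspace a"
  then show "c *s x \<in> gen_eigenspace a"
    by (auto simp: gen_eigenspace_def shift_power_scale)
qed

text \<open>Applying \<open>shift a\<close> changes the annihilating exponent by at most one. The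
  direction from left to right is the one that lets later arguments pull membership back through
  \<open>shift a\<close>.\<close>

lemma shift_in_gen_eigenspace_iff: "shift a x \<in> gen_eigenspace a \<longleftrightarrow> x \<in> gen_eigenspace a"
proof
  assume "shift a x \<in> gen_eigenspace a"
  then obtain n where "(shift a ^^ Suc n) x = 0"
    by (auto simp: gen_eigenspace_def shift_power_swap)
  then show "x \<in> gen_eigenspace a" by (rule gen_eigenspaceI)
next
  assume "x \<in> gen_eigenspace a"
  then obtain n where "(shift a ^^ n) x = 0"
    by (auto simp: gen_eigenspace_def)
  then have "(shift a ^^ n) (shift a x) = 0"
    by (simp add: shift_power_swap shift_zero)
  then show "shift a x \<in> gen_eigenspace a" by (rule gen_eigenspaceI)
qed

lemma D_in_gen_eigenspace:
  assumes "x \<in> gen_eigenspace a"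
  shows "D x \<in> gen_eigenspace a"
proof -
  have "D x = shift a x + a *s x" by (simp add: shift_def)
  then show ?thesis
    using assms subspace_gen_eigenspace
    by (simp add: shift_in_gen_eigenspace_iff subspace_add subspace_scale)
qed

lemma shift_power_in_gen_eigenspace:
  assumes "x \<in> gen_eigenspace a"
  shows "(shift b ^^ n) x \<in> gen_eigenspace a"
proof (induction n)
  case (Suc n)
  then show ?case
    using subspace_gen_eigenspace
    by (simp add: shift_def D_in_gen_eigenspace subspace_diff subspace_scale)
qed (simp add: assms)

text \<open>On the kernel of \<open>shift a\<close> the operator \<open>shift b\<close> is
  multiplication by the nonzero scalar \<open>a - b\<close>, so none of its powers kills a nonzero
  vector there.\<close>

lemma shift_eq_0_on_gen_eigenspace:
  assumes "a \<noteq> b" "x \<in> gen_eigenspace b" "shift a x = 0"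
  shows "x = 0"
proof -
  have "shift b x = (a - b) *s x"
    using assms(3) by (simp add: shift_def scale_left_diff_distrib)
  then have "(shift b ^^ n) x = (a - b) ^ n *s x" for n
    by (induction n) (simp_all add: shift_scale mult.commute)
  then show ?thesis using assms(1,2) by (auto simp: gen_eigenspace_def)
qed

text \<open>The factors \<open>shift a\<close> are cancelled one at a time; the intermediate vectors
  stay in \<open>gen_eigenspace b\<close>, where each factor is injective.\<close>

lemma shift_power_eq_0_on_gen_eigenspace:
  assumes "a \<noteq> b" "x \<in> gen_eigenspace b" "(shift a ^^ n) x = 0"
  shows "x = 0"
  using assms(3)
proof (induction n)
  case (Suc n)
  then show ?case
    using shift_eq_0_on_gen_eigenspace[OF assms(1) shift_power_in_gen_eigenspace[OF assms(2)]]
    by simp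
qed simp

text \<open>The identity \<open>shift a w - shift b w = (b - a) *s w\<close> reduces a preimage of
  \<open>w\<close> to a preimage of \<open>shift b w\<close>, which is annihilated by a smaller
  power of \<open>shift b\<close>. Hence the induction on that power.\<close>

lemma shift_surj_on_gen_eigenspace:
  assumes "a \<noteq> b" "w \<in> gen_eigenspace b"
  shows "\<exists>u\<in>gen_eigenspace b. shift a u = w"
proof -
  have "\<exists>u\<in>gen_eigenspace b. shift a u = w" if "(shift b ^^ n) w = 0" for n
    using that
  proof (induction n arbitrary: w)
    case 0
    then show ?case
      using subspace_0[OF subspace_gen_eigenspace] shift_zero by auto
  next
    case (Suc n)
    then have "(shift b ^^ n) (shift b w) = 0"
      by (simp add: shift_power_swap)
    from Suc.IH[OF this] obtain u where u: "u \<in> gen_eigenspace b" "shift a u = shift b w"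
      by blast
    have w: "w \<in> gen_eigenspace b" using Suc.prems by (rule gen_eigenspaceI)
    have "shift a (w - u) = shift a w - shift b w"
      using shift_add[of a "w - u" u] u(2) by simp
    then have "shift a (w - u) = (b - a) *s w"
      by (simp add: shift_def scale_left_diff_distrib)
    then have "shift a (inverse (b - a) *s (w - u)) = w"
      using assms(1) by (simp add: shift_scale)
    moreover have "inverse (b - a) *s (w - u) \<in> gen_eigenspace b"
      using u(1) w subspace_gen_eigenspace by (simp add: subspace_diff subspace_scale)
    ultimately show ?case by blast
  qed
  then show ?thesis using assms(2) by (auto simp: gen_eigenspace_def)
qed

text \<open>Every vector of the span has the form \<open>shift a u\<close> modulo
  \<open>gen_eigenspace a\<close>, with \<open>u\<close> in the span: on \<open>L\<^sub>b\<close>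
  with \<open>b\<close> different from \<open>a\<close> by surjectivity, on \<open>L\<^sub>a\<close>
  with \<open>u = 0\<close>. For the vector \<open>shift a x\<close> this puts
  \<open>shift a (x - u)\<close>, and hence \<open>x - u\<close>, into
  \<open>gen_eigenspace a\<close>.\<close>

lemma shift_in_span_gen_eigenspaces:
  assumes "shift a x \<in> span (\<Union>b. gen_eigenspace b)"
  shows "x \<in> span (\<Union>b. gen_eigenspace b)"
proof -
  let ?W = "span (\<Union>b. gen_eigenspace b)"
  have "\<exists>u\<in>?W. w - shift a u \<in> gen_eigenspace a" if "w \<in> ?W" for w
    using that
  proof (induction w rule: span_induct_alt)
    case base
    then show ?case
      using subspace_0[OF subspace_gen_eigenspace] shift_zero span_zero by (intro bexI[of _ 0]) auto
  next
    case (step c x y)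
    then obtain u where u: "u \<in> ?W" "y - shift a u \<in> gen_eigenspace a" by blast
    obtain b where b: "x \<in> gen_eigenspace b" using step by blast
    have "\<exists>v\<in>?W. x - shift a v \<in> gen_eigenspace a"
    proof (cases "a = b")
      case True
      then show ?thesis using b shift_zero span_zero by (intro bexI[of _ 0]) auto
    next
      case False
      then obtain v where "v \<in> gen_eigenspace b" "shift a v = x"
        using shift_surj_on_gen_eigenspace b by blast
      then show ?thesis
        using subspace_0[OF subspace_gen_eigenspace] by (intro bexI[of _ v]) (auto intro: span_base)
    qed
    then obtain v where v: "v \<in> ?W" "x - shift a v \<in> gen_eigenspace a" by blast
    have "c *s x + y - shift a (c *s v + u) = c *s (x - shift a v) + (y - shift a u)"
      by (simp add: shift_add shift_scale scale_right_diff_distrib)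
    also have "\<dots> \<in> gen_eigenspace a"
      using u v subspace_gen_eigenspace by (simp add: subspace_add subspace_scale)
    finally show ?case using u v by (intro bexI[of _ "c *s v + u"]) (auto intro: span_add span_scale)
  qed
  from this[OF assms] obtain u where u: "u \<in> ?W" "shift a x - shift a u \<in> gen_eigenspace a"
    by blast
  have "shift a x - shift a u = shift a (x - u)"
    using shift_add[of a "x - u" u] by simp
  then have "x - u \<in> ?W"
    using u(2) by (auto simp: shift_in_gen_eigenspace_iff intro: span_base)
  then show ?thesis using span_add[OF _ u(1), of "x - u"] by simp
qed

text \<open>A power of \<open>shift b\<close> that kills \<open>u b\<close> turns the relation into
  one over the smaller set \<open>S\<close>. By induction its terms vanish, and that power is
  injective on the other generalized eigenspaces.\<close>

lemma gen_eigenspaces_independent: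
  assumes "finite S" "\<And>a. a \<in> S \<Longrightarrow> u a \<in> gen_eigenspace a" "(\<Sum>a\<in>S. u a) = 0" "a \<in> S"
  shows "u a = 0"
  using assms
proof (induction S arbitrary: u a rule: finite_induct)
  case (insert b S)
  obtain n where n: "(shift b ^^ n) (u b) = 0"
    using insert.prems(1)[of b] by (auto simp: gen_eigenspace_def)
  have power_sum: "(shift b ^^ n) (\<Sum>a\<in>S. u a) = (\<Sum>a\<in>S. (shift b ^^ n) (u a))"
    using insert.hyps(1) by (induction S) (simp_all add: shift_power_zero shift_power_add)
  have "(shift b ^^ n) (u b + (\<Sum>a\<in>S. u a)) = 0"
    using insert by (simp add: shift_power_zero)
  then have "(\<Sum>a\<in>S. (shift b ^^ n) (u a)) = 0"
    by (simp add: shift_power_add n power_sum)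
  then have "(shift b ^^ n) (u a) = 0" if "a \<in> S" for a
    using insert.IH[of "\<lambda>a. (shift b ^^ n) (u a)" a] insert.prems(1) that
    by (simp add: shift_power_in_gen_eigenspace)
  then have S: "u a = 0" if "a \<in> S" for a
    using shift_power_eq_0_on_gen_eigenspace[of b a "u a" n] insert.prems(1)[of a] insert.hyps(2) that
    by auto
  moreover have "u b = 0"
    using insert.prems(2) insert.hyps S by simp
  ultimately show ?case using insert.prems(3) by auto
qed simp

section \<open>Polynomials in the operator and annihilation of a single vector\<close>

text \<open>This is the vector \<open>p(D) x\<close>, computed by Horner's scheme.\<close>

definition poly_apply :: "'f poly \<Rightarrow> 'a \<Rightarrow> 'a" where
  "poly_apply p = fold_coeffs (\<lambda>c g x. c *s x + D (g x)) p (\<lambda>_. 0)"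

lemma poly_apply_0: "poly_apply 0 x = 0"
  by (simp add: poly_apply_def)

lemma poly_apply_pCons: "poly_apply (pCons c p) x = c *s x + D (poly_apply p x)"
  by (cases "p = 0"; cases "c = 0") (simp_all add: poly_apply_def D_zero)

lemma poly_apply_add: "poly_apply (p + q) x = poly_apply p x + poly_apply q x"
  by (induction p q rule: poly_induct2)
     (simp_all add: poly_apply_0 poly_apply_pCons D_add scale_left_distrib)

lemma poly_apply_smult: "poly_apply (smult c p) x = c *s poly_apply p x"
  by (induction p) (simp_all add: poly_apply_0 poly_apply_pCons D_scale scale_right_distrib)

lemma poly_apply_monom: "poly_apply (monom c n) x = c *s (D ^^ n) x"
  by (induction n) (simp_all add: monom_0 monom_Suc poly_apply_0 poly_apply_pCons D_zero D_scale)

lemma poly_apply_linear_mult: "poly_apply ([:- a, 1:] * q) x = shift a (poly_apply q x)"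
  using poly_apply_add[of "[:- a, 1:] * q" "smult a q" x]
  by (simp add: poly_apply_smult poly_apply_pCons shift_def)

text \<open>The bound on \<open>p\<close> is put on coefficients rather than on the degree, so that
  \<open>n = 0\<close> is covered as well: it forces \<open>p = 0\<close>.\<close>

lemma span_powers_eq_poly_apply:
  assumes "y \<in> span ((\<lambda>i. (D ^^ i) x) ` {..<n})"
  shows "\<exists>p. (\<forall>i\<ge>n. coeff p i = 0) \<and> y = poly_apply p x"
  using assms
proof (induction y rule: span_induct_alt)
  case base
  then show ?case by (intro exI[of _ 0]) (simp add: poly_apply_0)
next
  case (step c z y)
  then obtain p i where "\<forall>i\<ge>n. coeff p i = 0" "y = poly_apply p x" "i < n" "z = (D ^^ i) x"
    by auto
  then show ?case
    by (intro exI[of _ "monom c i + p"]) (auto simp: poly_apply_add poly_apply_monom)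
qed

text \<open>If no \<open>(D ^^ n) x\<close> depended linearly on the earlier iterates, the first
  \<open>card B + 1\<close> iterates would be independent, too many for a space spanned by
  \<open>B\<close>. The polynomial may depend on \<open>x\<close>.\<close>

lemma annihilating_poly:
  assumes "finite B" "span B = UNIV"
  shows "\<exists>p. p \<noteq> 0 \<and> poly_apply p x = 0"
proof -
  let ?S = "\<lambda>n. (\<lambda>i. (D ^^ i) x) ` {..<n}"
  have "\<exists>n. (D ^^ n) x \<in> span (?S n)"
  proof (rule ccontr)
    assume notin: "\<nexists>n. (D ^^ n) x \<in> span (?S n)"
    have "independent (?S n) \<and> card (?S n) = n" for n
    proof (induction n)
      case (Suc n)
      have eq: "?S (Suc n) = insert ((D ^^ n) x) (?S n)"
        by (auto simp: less_Suc_eq)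
      have "(D ^^ n) x \<notin> span (?S n)" using notin by blast
      then show ?case
        using Suc span_base[of "(D ^^ n) x" "?S n"] unfolding eq by (auto simp: independent_insert)
    qed (simp add: independent_empty)
    then show False
      using independent_span_bound[OF assms(1), of "?S (Suc (card B))"] assms(2)
      by (metis Suc_n_not_le_n subset_UNIV)
  qed
  then obtain n p where p: "\<forall>i\<ge>n. coeff p i = 0" "(D ^^ n) x = poly_apply p x"
    using span_powers_eq_poly_apply by blast
  \<comment> \<open>The dependence relation is read as a monic polynomial: \<open>p\<close> has no
    coefficient at \<open>n\<close>, so the leading term survives.\<close>
  have "coeff (monom 1 n + smult (- 1) p) n \<noteq> 0" using p(1) by simp
  then have "monom 1 n + smult (- 1) p \<noteq> 0" by (metis coeff_0)
  moreover have "poly_apply (monom 1 n + smult (- 1) p) x = 0"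
    using p(2) by (simp only: poly_apply_add poly_apply_monom poly_apply_smult) simp
  ultimately show ?thesis by blast
qed

end

section \<open>Algebraically closed fields: the decomposition of the space and the two parts of the
  operator\<close>

locale linear_operator_alg_closed = linear_operator scale D
  for scale :: "'f::alg_closed_field \<Rightarrow> 'a::ab_group_add \<Rightarrow> 'a" (infixr "*s" 75) and D +
  assumes finite_dimensional: "\<exists>B. finite B \<and> span B = UNIV"
begin

lemma span_gen_eigenspaces: "span (\<Union>a. gen_eigenspace a) = UNIV"
proof -
  let ?W = "span (\<Union>a. gen_eigenspace a)"
  have "x \<in> ?W" for x
  proof -
    \<comment> \<open>Membership in \<open>?W\<close> replaces \<open>poly_apply p x = 0\<close> to
      make the induction on the degree go through: splitting off a root \<open>a\<close> leaves
      \<open>shift a (poly_apply q x)\<close> in \<open>?W\<close>, and \<open>shift a\<close> can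
      be removed. A nonzero constant is divided out at the end.\<close>
    have "x \<in> ?W" if "p \<noteq> 0" "poly_apply p x \<in> ?W" for p
      using that
    proof (induction "degree p" arbitrary: p)
      case 0
      then obtain c where "p = [:c:]" "c \<noteq> 0"
        by (metis degree_eq_zeroE pCons_0_0)
      then show ?case
        using 0 span_scale[of "c *s x" _ "inverse c"]
        by (simp add: poly_apply_pCons poly_apply_0 D_zero)
    next
      case (Suc n)
      then obtain a where "poly p a = 0"
        using alg_closed_imp_poly_has_root[of p] by auto
      then obtain q where q: "p = [:- a, 1:] * q"
        by (auto simp: poly_eq_0_iff_dvd elim: dvdE)
      have "q \<noteq> 0" using Suc.prems q by auto
      moreover from this have "degree p = Suc (degree q)"
        unfolding q by (subst degree_mult_eq) auto
      ultimately show ?case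
        using Suc.hyps Suc.prems(2) shift_in_span_gen_eigenspaces unfolding q poly_apply_linear_mult
        by auto
    qed
    then show ?thesis
      using annihilating_poly finite_dimensional span_zero by metis
  qed
  then show ?thesis by blast
qed

lemma linear_eq_on_gen_eigenspaces:
  assumes "Vector_Spaces.linear scale scale f" "Vector_Spaces.linear scale scale g"
    and "\<And>a x. x \<in> gen_eigenspace a \<Longrightarrow> f x = g x"
  shows "f = g"
proof
  fix x
  show "f x = g x"
  proof (rule endo.linear_eq_on[OF assms(1,2)])
    show "x \<in> span (\<Union>a. gen_eigenspace a)" by (simp add: span_gen_eigenspaces)
  qed (use assms(3) in blast)
qed

text \<open>\<open>D0\<close> is prescribed on a basis of generalized eigenvectors, which makes it
  diagonalizable at once. The work is to show that it acts as the scalar \<open>a\<close> on all of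
  \<open>gen_eigenspace a\<close>, not only on the basis vectors chosen there.\<close>

lemma diagonalizable_part_exists:
  "\<exists>D0. Vector_Spaces.linear scale scale D0 \<and> diagonalizable D0 \<and>
        (\<forall>a. \<forall>x\<in>gen_eigenspace a. D0 x = a *s x)"
proof -
  obtain B where B: "B \<subseteq> (\<Union>a. gen_eigenspace a)" "independent B"
      "(\<Union>a. gen_eigenspace a) \<subseteq> span B"
    using maximal_independent_subset by blast
  have span_B: "span B = UNIV"
    using span_minimal[OF B(3) subspace_span] by (simp add: span_gen_eigenspaces top.extremum_unique)
  have "\<forall>b\<in>B. \<exists>a. b \<in> gen_eigenspace a" using B(1) by blast
  then obtain ev where ev: "\<And>b. b \<in> B \<Longrightarrow> b \<in> gen_eigenspace (ev b)" by metis
  define D0 where "D0 = endo.construct B (\<lambda>b. ev b *s b)"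
  have linear: "Vector_Spaces.linear scale scale D0"
    unfolding D0_def by (rule endo.linear_construct[OF B(2)])
  have D0_basis: "D0 b = ev b *s b" if "b \<in> B" for b
    unfolding D0_def by (rule endo.construct_basis[OF B(2) that])
  have "diagonalizable D0"
    unfolding diagonalizable_def using B(2) span_B D0_basis by blast
  moreover have "D0 x = a *s x" if x: "x \<in> gen_eigenspace a" for a x
  proof -
    \<comment> \<open>The basis expansion is grouped by eigenvalue, so that each group lies in one
      generalized eigenspace and is scaled by \<open>D0\<close> accordingly.\<close>
    have sum_of_eigenvectors:
      "\<exists>S u. finite S \<and> (\<forall>b\<in>S. u b \<in> gen_eigenspace b \<and> D0 (u b) = b *s u b) \<and> y = (\<Sum>b\<in>S. u b)"
      if "y \<in> span B" for y
      using that
    proof (induction y rule: span_induct_alt)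
      case base
      show ?case by (intro exI[of _ "{}"]) simp
    next
      case (step c z y)
      then obtain S u where S: "finite S"
          "\<And>b. b \<in> S \<Longrightarrow> u b \<in> gen_eigenspace b \<and> D0 (u b) = b *s u b" "y = (\<Sum>b\<in>S. u b)"
        by blast
      \<comment> \<open>Extending by zero matters because \<open>ev z\<close> may lie outside
        \<open>S\<close>, where nothing is known about \<open>u\<close>.\<close>
      define u' where "u' b = (if b \<in> S then u b else 0)" for b
      define v where "v b = u' b + (if b = ev z then c *s z else 0)" for b
      have "u' b \<in> gen_eigenspace b \<and> D0 (u' b) = b *s u' b" for b
        using S(2) endo.linear_0[OF linear] subspace_0[OF subspace_gen_eigenspace]
        by (simp add: u'_def)
      moreover have "c *s z \<in> gen_eigenspace (ev z)" "D0 (c *s z) = ev z *s (c *s z)"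
        using ev[of z] step D0_basis[of z] subspace_scale[OF subspace_gen_eigenspace]
        by (simp_all add: endo.linear_scale[OF linear] mult.commute)
      ultimately have "v b \<in> gen_eigenspace b \<and> D0 (v b) = b *s v b" for b
        using subspace_add[OF subspace_gen_eigenspace]
        by (simp add: v_def endo.linear_add[OF linear] endo.linear_0[OF linear] scale_right_distrib)
      moreover have "c *s z + y = (\<Sum>b\<in>insert (ev z) S. v b)"
      proof -
        have "(\<Sum>b\<in>insert (ev z) S. u' b) = y"
          unfolding S(3) by (rule sum.mono_neutral_cong_right) (auto simp: S(1) u'_def)
        then show ?thesis
          using S(1) by (simp add: v_def sum.distrib sum.delta del: sum.insert_if sum.insert)
      qed
      ultimately show ?case using S(1) by (intro exI[of _ "insert (ev z) S"] exI[of _ v]) auto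
    qed
    have "x \<in> span B" by (simp add: span_B)
    from sum_of_eigenvectors[OF this] obtain S u where S: "finite S" "x = (\<Sum>b\<in>S. u b)"
      and u: "\<And>b. b \<in> S \<Longrightarrow> u b \<in> gen_eigenspace b \<and> D0 (u b) = b *s u b"
      by blast
    define u' where "u' b = (if b \<in> S then u b else 0)" for b
    \<comment> \<open>Moving \<open>x\<close> into the component at \<open>a\<close> gives a family
      with sum zero; independence then identifies \<open>x\<close> with its own component
      \<open>u' a\<close>.\<close>
    define v where "v b = u' b - (if b = a then x else 0)" for b
    have u': "u' b \<in> gen_eigenspace b \<and> D0 (u' b) = b *s u' b" for b
      using u endo.linear_0[OF linear] subspace_0[OF subspace_gen_eigenspace] by (simp add: u'_def)
    have "v b \<in> gen_eigenspace b" for b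
      using u' x subspace_diff[OF subspace_gen_eigenspace] by (simp add: v_def)
    moreover have "(\<Sum>b\<in>insert a S. v b) = 0"
    proof -
      have "(\<Sum>b\<in>insert a S. u' b) = x"
        unfolding S(2) by (rule sum.mono_neutral_cong_right) (auto simp: S(1) u'_def)
      then show ?thesis
        using S(1) by (simp add: v_def sum_subtractf sum.delta del: sum.insert_if sum.insert)
    qed
    ultimately have "v a = 0"
      using gen_eigenspaces_independent[of "insert a S" v a] S(1) by blast
    then have "x = u' a" by (simp add: v_def)
    then show ?thesis using u'[of a] by simp
  qed
  ultimately show ?thesis using linear by blast
qed

text \<open>On \<open>gen_eigenspace a\<close> the powers of \<open>T\<close> are those of
  \<open>shift a\<close>, so every vector is killed by some power. A finite spanning set makes the
  exponent uniform.\<close>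

lemma nilpotent_part:
  assumes "Vector_Spaces.linear scale scale T"
    and "\<And>a x. x \<in> gen_eigenspace a \<Longrightarrow> T x = shift a x"
  shows "nilpotent T"
proof -
  have power: "(T ^^ n) x = (shift a ^^ n) x" if "x \<in> gen_eigenspace a" for n a x
    by (induction n) (simp_all add: assms(2) shift_power_in_gen_eigenspace[OF that])
  have linear_power: "Vector_Spaces.linear scale scale (T ^^ n)" for n
    using assms(1) by (induction n) (simp_all add: Vector_Spaces.linear_iff)
  have mono: "(T ^^ n) x = 0" if "(T ^^ m) x = 0" "m \<le> n" for m n x
    using that endo.linear_0[OF linear_power] by (metis comp_apply funpow_add le_add_diff_inverse2)
  have local: "\<exists>n. (T ^^ n) x = 0" for x
  proof -
    have "x \<in> span (\<Union>a. gen_eigenspace a)" by (simp add: span_gen_eigenspaces)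
    then show ?thesis
    proof (induction x rule: span_induct_alt)
      case base
      show ?case by (intro exI[of _ 0]) simp
    next
      case (step c x y)
      then obtain m n where "(T ^^ m) x = 0" "(T ^^ n) y = 0"
        using power by (auto simp: gen_eigenspace_def) metis
      then show ?case
        using mono[of m x "max m n"] mono[of n y "max m n"]
        by (intro exI[of _ "max m n"])
           (simp add: endo.linear_add[OF linear_power] endo.linear_scale[OF linear_power])
    qed
  qed
  then obtain k where k: "\<And>x. (T ^^ k x) x = 0" by metis
  obtain B where B: "finite B" "span B = UNIV" using finite_dimensional by blast
  \<comment> \<open>The inserted 0 keeps the maximum meaningful when \<open>B\<close> is
    empty.\<close>
  define N where "N = Max (insert 0 (k ` B))"
  have "(T ^^ N) b = 0" if "b \<in> B" for b
    using mono[OF k] that B(1) by (simp add: N_def)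
  then have "(T ^^ N) x = 0" for x
    using endo.linear_eq_0_on_span[OF linear_power, of B] B(2) by auto
  then show ?thesis unfolding nilpotent_def by blast
qed

text \<open>It suffices to compare the two maps on a basis of eigenvectors of \<open>D0'\<close>.
  Such a vector with eigenvalue \<open>c\<close> lies in \<open>gen_eigenspace c\<close>, where
  \<open>D0\<close> is the scalar \<open>c\<close> too.\<close>

lemma diagonalizable_part_unique:
  assumes linear: "Vector_Spaces.linear scale scale D0'" "Vector_Spaces.linear scale scale T"
    and diag: "diagonalizable D0'" and nil: "nilpotent T"
    and D: "D = (\<lambda>x. D0' x + T x)" and comm: "D0' \<circ> T = T \<circ> D0'"
    and D0: "Vector_Spaces.linear scale scale D0" "\<And>a x. x \<in> gen_eigenspace a \<Longrightarrow> D0 x = a *s x"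
  shows "D0' = D0"
proof -
  obtain B where B: "span B = UNIV" "\<forall>b\<in>B. \<exists>c. D0' b = c *s b"
    using diag unfolding diagonalizable_def by blast
  have "D0' b = D0 b" if "b \<in> B" for b
  proof -
    obtain c where c: "D0' b = c *s b" using B(2) \<open>b \<in> B\<close> by blast
    \<comment> \<open>Commutation keeps all iterates of \<open>b\<close> under \<open>T\<close> in
      the \<open>c\<close>-eigenspace of \<open>D0'\<close>; there \<open>shift c\<close> and
      \<open>T\<close> coincide, so their powers agree on \<open>b\<close>.\<close>
    have eigen: "D0' ((T ^^ n) b) = c *s (T ^^ n) b" for n
    proof (induction n)
      case (Suc n)
      then show ?case
        using fun_cong[OF comm, of "(T ^^ n) b"] by (simp add: endo.linear_scale[OF linear(2)])
    qed (simp add: c)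
    have "shift c y = D0' y + T y - c *s y" for y
      using fun_cong[OF D, of y] by (simp only: shift_def)
    then have "(shift c ^^ n) b = (T ^^ n) b" for n
      by (induction n) (simp_all add: eigen)
    then have "b \<in> gen_eigenspace c"
      using nil unfolding nilpotent_def by (metis gen_eigenspaceI)
    then show ?thesis using c D0(2) by simp
  qed
  then show ?thesis
    using endo.linear_eq_on[OF linear(1) D0(1), of _ B] B(1) by auto
qed

end

section \<open>Derivations of a Leibniz algebra\<close>

locale derivation_operator = right_leibniz_algebra scale bracket + linear_operator scale D
  for scale :: "'f::field \<Rightarrow> 'a::ab_group_add \<Rightarrow> 'a" (infixr "*s" 75) and bracket D +
  assumes derivation_D: "derivation D"
begin

lemmas bracket_add_left = endo.linear_add[OF linear_left]
  and bracket_scale_left = endo.linear_scale[OF linear_left]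
  and bracket_diff_left = endo.linear_diff[OF linear_left]
  and bracket_zero_left = endo.linear_0[OF linear_left]
  and bracket_add_right = endo.linear_add[OF linear_right]
  and bracket_scale_right = endo.linear_scale[OF linear_right]
  and bracket_diff_right = endo.linear_diff[OF linear_right]
  and bracket_zero_right = endo.linear_0[OF linear_right]

text \<open>The product rule for \<open>D\<close> survives the shift because the scalar
  \<open>a + b\<close> splits over the two arguments of the bracket.\<close>

lemma shift_bracket:
  "shift (a + b) (bracket x y) = bracket (shift a x) y + bracket x (shift b y)"
  using derivation_D unfolding derivation_def
  by (simp add: shift_def bracket_diff_left bracket_diff_right bracket_scale_left
      bracket_scale_right scale_left_distrib algebra_simps)

text \<open>Each summand of \<open>shift_bracket\<close> lowers one of the two annihilating
  exponents, so induction on their sum handles both; this takes the place of a binomial expansion of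
  the powers.\<close>

lemma bracket_gen_eigenspace:
  assumes "x \<in> gen_eigenspace a" "y \<in> gen_eigenspace b"
  shows "bracket x y \<in> gen_eigenspace (a + b)"
proof -
  have "bracket x y \<in> gen_eigenspace (a + b)" if "(shift a ^^ m) x = 0" "(shift b ^^ n) y = 0" for m n
    using that
  proof (induction "m + n" arbitrary: m n x y rule: less_induct)
    case less
    show ?case
    proof (cases "m = 0 \<or> n = 0")
      case True
      then show ?thesis
        using less.prems subspace_0[OF subspace_gen_eigenspace]
        by (auto simp: bracket_zero_left bracket_zero_right)
    next
      case False
      then obtain m' n' where mn: "m = Suc m'" "n = Suc n'" by (metis nat.exhaust)
      have "bracket (shift a x) y \<in> gen_eigenspace (a + b)"
        using less.prems mn by (intro less.hyps[of m' n]) (simp_all add: shift_power_swap)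
      moreover have "bracket x (shift b y) \<in> gen_eigenspace (a + b)"
        using less.prems mn by (intro less.hyps[of m n']) (simp_all add: shift_power_swap)
      ultimately have "shift (a + b) (bracket x y) \<in> gen_eigenspace (a + b)"
        unfolding shift_bracket by (rule subspace_add[OF subspace_gen_eigenspace])
      then show ?thesis by (simp add: shift_in_gen_eigenspace_iff)
    qed
  qed
  then show ?thesis using assms by (auto simp: gen_eigenspace_def)
qed

end

locale derivation_operator_alg_closed =
  derivation_operator scale bracket D + linear_operator_alg_closed scale D
  for scale :: "'f::alg_closed_field \<Rightarrow> 'a::ab_group_add \<Rightarrow> 'a" (infixr "*s" 75) and bracket D
begin

text \<open>For \<open>x\<close> in \<open>L\<^sub>a\<close> and \<open>y\<close> in
  \<open>L\<^sub>b\<close> both sides of the product rule equal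
  \<open>(a + b) *s bracket x y\<close>. Linearity extends this first in \<open>y\<close>, then in
  \<open>x\<close>.\<close>

lemma diagonalizable_part_derivation:
  assumes linear: "Vector_Spaces.linear scale scale D0"
    and D0: "\<And>a x. x \<in> gen_eigenspace a \<Longrightarrow> D0 x = a *s x"
  shows "derivation D0"
proof -
  note linear_simps = endo.linear_add[OF linear] endo.linear_scale[OF linear] endo.linear_0[OF linear]
    bracket_add_left bracket_add_right bracket_scale_left bracket_scale_right
    bracket_zero_left bracket_zero_right scale_right_distrib
  let ?P = "\<lambda>x y. D0 (bracket x y) = bracket (D0 x) y + bracket x (D0 y)"
  have gen: "?P x y" if "x \<in> gen_eigenspace a" "y \<in> gen_eigenspace b" for x y a b
    using D0[OF that(1)] D0[OF that(2)] D0[OF bracket_gen_eigenspace[OF that]]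
    by (simp add: linear_simps scale_left_distrib)
  have right: "?P x y" if "x \<in> gen_eigenspace a" for x y a
  proof -
    have "y \<in> span (\<Union>b. gen_eigenspace b)" by (simp add: span_gen_eigenspaces)
    then show ?thesis
    proof (induction y rule: span_induct_alt)
      case (step c z y)
      then have "?P x z" using gen that by blast
      then show ?case using step by (simp add: linear_simps)
    qed (simp add: linear_simps)
  qed
  have "?P x y" for x y
  proof -
    have "x \<in> span (\<Union>b. gen_eigenspace b)" by (simp add: span_gen_eigenspaces)
    then show ?thesis
    proof (induction x rule: span_induct_alt)
      case (step c z x)
      then have "?P z y" using right by blast
      then show ?case using step by (simp add: linear_simps)
    qed (simp add: linear_simps)
  qed
  then show ?thesis using linear unfolding derivation_def by blast
qed

theorem jordan_chevalley_derivation: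
  "\<exists>!p. case p of (D0, T) \<Rightarrow> derivation D0 \<and> diagonalizable D0 \<and> derivation T \<and> nilpotent T \<and>
     D = (\<lambda>x. D0 x + T x) \<and> D0 \<circ> T = T \<circ> D0"
proof -
  obtain D0 where linear: "Vector_Spaces.linear scale scale D0" and diag: "diagonalizable D0"
    and D0: "\<And>a x. x \<in> gen_eigenspace a \<Longrightarrow> D0 x = a *s x"
    using diagonalizable_part_exists by blast
  define T where "T x = D x - D0 x" for x
  have linear_T: "Vector_Spaces.linear scale scale T"
    unfolding T_def using linear_D linear by (rule endo.linear_compose_sub)
  have der_D0: "derivation D0" by (rule diagonalizable_part_derivation[OF linear D0])
  have der_T: "derivation T"
    using linear_T der_D0 derivation_D unfolding derivation_def
    by (simp add: T_def bracket_diff_left bracket_diff_right)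
  have T_gen: "T x = shift a x" if "x \<in> gen_eigenspace a" for a x
    using that by (simp add: T_def shift_def D0)
  have nil: "nilpotent T" by (rule nilpotent_part[OF linear_T T_gen])
  \<comment> \<open>On \<open>L\<^sub>a\<close> the map \<open>D0\<close> is the scalar
    \<open>a\<close>, and \<open>T\<close> maps \<open>L\<^sub>a\<close> into itself, so both
    composites are \<open>a *s T x\<close>.\<close>
  have comm: "D0 \<circ> T = T \<circ> D0"
  proof (rule linear_eq_on_gen_eigenspaces)
    fix a x assume "x \<in> gen_eigenspace a"
    then show "(D0 \<circ> T) x = (T \<circ> D0) x"
      by (simp add: T_gen D0 shift_in_gen_eigenspace_iff endo.linear_scale[OF linear_T])
  qed (rule Vector_Spaces.linear_compose linear linear_T)+
  show ?thesis
  proof (rule ex1I[of _ "(D0, T)"])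
    show "case (D0, T) of (D0, T) \<Rightarrow> derivation D0 \<and> diagonalizable D0 \<and> derivation T \<and>
        nilpotent T \<and> D = (\<lambda>x. D0 x + T x) \<and> D0 \<circ> T = T \<circ> D0"
      using der_D0 diag der_T nil comm by (simp add: T_def)
  next
    fix p
    assume p: "case p of (D0, T) \<Rightarrow> derivation D0 \<and> diagonalizable D0 \<and> derivation T \<and>
        nilpotent T \<and> D = (\<lambda>x. D0 x + T x) \<and> D0 \<circ> T = T \<circ> D0"
    obtain D0' T' where p_eq: "p = (D0', T')" by (cases p)
    have D_eq: "D = (\<lambda>x. D0' x + T' x)" using p p_eq by simp
    have "D0' = D0"
      by (rule diagonalizable_part_unique[of D0' T' D0])
         (use p p_eq linear D0 in \<open>simp_all add: derivation_def\<close>)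
    moreover from this have "T' = T"
      using D_eq by (auto simp: T_def fun_eq_iff)
    ultimately show "p = (D0, T)" using p_eq by simp
  qed
qed

end

theorem theorem3p2:
  fixes scale :: "complex \<Rightarrow> 'a::ab_group_add \<Rightarrow> 'a"
    and bracket :: "'a \<Rightarrow> 'a \<Rightarrow> 'a"
    and D :: "'a \<Rightarrow> 'a"
  assumes "finite_dimensional_right_leibniz_algebra scale bracket"
    and "right_leibniz_algebra.derivation scale bracket D"
  shows "\<exists>!p :: ('a \<Rightarrow> 'a) \<times> ('a \<Rightarrow> 'a). case p of (D0, T) \<Rightarrow>
           right_leibniz_algebra.derivation scale bracket D0 \<and>
           vector_space.diagonalizable scale D0 \<and>
           right_leibniz_algebra.derivation scale bracket T \<and>
           vector_space.nilpotent T \<and>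
           D = (\<lambda>x. D0 x + T x) \<and>
           D0 \<circ> T = T \<circ> D0"
proof -
  interpret finite_dimensional_right_leibniz_algebra scale bracket by fact
  \<comment> \<open>The fundamental theorem of algebra enters here: it makes \<open>complex\<close>
    an algebraically closed field.\<close>
  interpret derivation_operator_alg_closed scale bracket D
    by (intro derivation_operator_alg_closed.intro derivation_operator.intro
        derivation_operator_axioms.intro linear_operator_alg_closed.intro
        linear_operator_alg_closed_axioms.intro linear_operator.intro linear_operator_axioms.intro
        right_leibniz_algebra_axioms vector_space_axioms finite_dimensional assms(2)
        assms(2)[unfolded derivation_def, THEN conjunct1])
  show ?thesis by (rule jordan_chevalley_derivation)
qed

end
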